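(* Suppose $\lambda=\mu^+$ for $\mu$ singular, and $(\bar C,\bar I)$ is an $S$-fair pair for some stationary $S\subseteq\{\delta<\lambda:\mathrm{cf}(\delta)=\mathrm{cf}(\mu)\}$. If $2^{\mathrm{cf}(\mu)}<\mu$, then there is a function $g:\lambda\to\mathrm{cf}(\mu)$ such that the ideal $g(\mathrm{id}_p(\bar C,\bar I)):=\{A\subseteq\mathrm{cf}(\mu):g^{-1}(A)\in\mathrm{id}_p(\bar C,\bar I)\}$ is exactly the ideal of bounded subsets of $\mathrm{cf}(\mu)$.
   Context: For a closed set $C$, $\mathrm{nacc}(C)=\{\alpha\in C:\sup(C\cap\alpha)<\alpha\}$, $\mathrm{acc}(C)=C\setminus\mathrm{nacc}(C)$. An $S$-fair pair is $(\bar C,\bar I)$ where $\bar C=\langle C_\delta:\delta\in S\rangle$ with each $C_\delta$ closed unbounded in $\delta$; $\bar I=\langle I_\delta:\delta\in S\rangle$ with $I_\delta$ the ideal on $C_\delta$ generated by the sets $\{\gamma\in C_\delta:\gamma\in\mathrm{acc}(C_\delta)\text{ or }\mathrm{cf}(\gamma)<\alpha\text{ or }\gamma<\beta\}$ for $\alpha<\mu$, $\beta<\delta$; and for every club $E\subseteq\lambda$, $\{\delta\in S:E\cap C_\delta\notin I_\delta\}$ is stationary. $\mathrm{id}_p(\bar C,\bar I)$ is the ideal of all $A\subseteq\lambda$ such that for some club $E\subseteq\lambda$, $E\cap A\cap C_\delta\in I_\delta$ for all $\delta\in S\cap E$. *)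

theory Defs
  imports Main
begin

unbundle cardinal_syntax

text \<open>
  Ordinals are the elements of an arbitrary well-ordered type, and an ordinal \<open>\<alpha>\<close>, regarded as the
  set of its predecessors, is \<open>{..<\<alpha>}\<close>.  The ordinal notions below depend only on the initial
  segment determined by their arguments, so they agree with the set-theoretic ones whatever the
  order type of the ambient type is.
\<close>

definition is_cardinal :: "'a::wellorder \<Rightarrow> bool" where
  "is_cardinal \<kappa> \<longleftrightarrow> (\<forall>\<alpha><\<kappa>. |{..<\<alpha>}| <o |{..<\<kappa>}| )"

definition is_succ_cardinal :: "'a::wellorder \<Rightarrow> 'a \<Rightarrow> bool" where
  "is_succ_cardinal lam \<mu> \<longleftrightarrow>
     is_cardinal lam \<and> \<mu> < lam \<and> (\<forall>\<kappa>. is_cardinal \<kappa> \<and> \<mu> < \<kappa> \<longrightarrow> lam \<le> \<kappa>)"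

definition cf :: "'a::wellorder \<Rightarrow> 'a" where
  "cf \<gamma> = (LEAST \<alpha>. \<exists>f. f ` {..<\<alpha>} \<subseteq> {..<\<gamma>} \<and> (\<forall>\<beta><\<gamma>. \<exists>\<xi><\<alpha>. \<beta> \<le> f \<xi>))"

definition singular_cardinal :: "'a::wellorder \<Rightarrow> bool" where
  "singular_cardinal \<mu> \<longleftrightarrow> is_cardinal \<mu> \<and> infinite {..<\<mu>} \<and> cf \<mu> < \<mu>"

text \<open>The supremum is only used for bounded sets; the supremum of the empty set is the ordinal 0.\<close>

definition osup :: "'a::wellorder set \<Rightarrow> 'a" where
  "osup X = (LEAST \<beta>. \<forall>\<xi>\<in>X. \<xi> \<le> \<beta>)"

definition nacc :: "'a::wellorder set \<Rightarrow> 'a set" where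
  "nacc C = {\<alpha>\<in>C. osup (C \<inter> {..<\<alpha>}) < \<alpha>}"

definition acc :: "'a::wellorder set \<Rightarrow> 'a set" where
  "acc C = C - nacc C"

definition club_in :: "'a::wellorder \<Rightarrow> 'a set \<Rightarrow> bool" where
  "club_in \<delta> C \<longleftrightarrow>
     C \<subseteq> {..<\<delta>} \<and>
     (\<forall>\<beta><\<delta>. \<exists>\<gamma>\<in>C. \<beta> < \<gamma>) \<and>
     (\<forall>\<gamma><\<delta>. C \<inter> {..<\<gamma>} \<noteq> {} \<and> osup (C \<inter> {..<\<gamma>}) = \<gamma> \<longrightarrow> \<gamma> \<in> C)"

definition stationary_in :: "'a::wellorder \<Rightarrow> 'a set \<Rightarrow> bool" where
  "stationary_in lam S \<longleftrightarrow> S \<subseteq> {..<lam} \<and> (\<forall>E. club_in lam E \<longrightarrow> S \<inter> E \<noteq> {})"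

text \<open>The generated ideal is allowed to be improper, i.e. to contain \<open>X\<close> itself.\<close>

definition generated_ideal :: "'b set \<Rightarrow> 'b set set \<Rightarrow> 'b set set" where
  "generated_ideal X G = {A. A \<subseteq> X \<and> (\<exists>F. finite F \<and> F \<subseteq> G \<and> A \<subseteq> \<Union>F)}"

definition fair_pair ::
  "'a::wellorder \<Rightarrow> 'a \<Rightarrow> 'a set \<Rightarrow> ('a \<Rightarrow> 'a set) \<Rightarrow> ('a \<Rightarrow> 'a set set) \<Rightarrow> bool" where
  "fair_pair lam \<mu> S C I \<longleftrightarrow>
     (\<forall>\<delta>\<in>S. club_in \<delta> (C \<delta>)) \<and>
     (\<forall>\<delta>\<in>S. I \<delta> = generated_ideal (C \<delta>)
        {{\<gamma> \<in> C \<delta>. \<gamma> \<in> acc (C \<delta>) \<or> cf \<gamma> < \<alpha> \<or> \<gamma> < \<beta>} | \<alpha> \<beta>. \<alpha> < \<mu> \<and> \<beta> < \<delta>}) \<and>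
     (\<forall>E. club_in lam E \<longrightarrow> stationary_in lam {\<delta>\<in>S. E \<inter> C \<delta> \<notin> I \<delta>})"

definition id_p ::
  "'a::wellorder \<Rightarrow> 'a set \<Rightarrow> ('a \<Rightarrow> 'a set) \<Rightarrow> ('a \<Rightarrow> 'a set set) \<Rightarrow> 'a set set" where
  "id_p lam S C I =
     {A. A \<subseteq> {..<lam} \<and> (\<exists>E. club_in lam E \<and> (\<forall>\<delta>\<in>S \<inter> E. E \<inter> A \<inter> C \<delta> \<in> I \<delta>))}"

definition image_ideal :: "('a \<Rightarrow> 'b) \<Rightarrow> 'a set \<Rightarrow> 'b set \<Rightarrow> 'a set set \<Rightarrow> 'b set set" where
  "image_ideal g X Y J = {A. A \<subseteq> Y \<and> g -` A \<inter> X \<in> J}"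

definition bounded_ideal :: "'a::wellorder \<Rightarrow> 'a set set" where
  "bounded_ideal \<kappa> = {A. A \<subseteq> {..<\<kappa>} \<and> (\<exists>\<beta><\<kappa>. \<forall>\<xi>\<in>A. \<xi> \<le> \<beta>)}"

end

theory Submission
  imports Defs
begin

text \<open>
  Let \<open>\<kappa> = cf \<mu>\<close>, fix a cofinal map \<open>f\<close> from \<open>\<kappa>\<close> to \<open>\<mu>\<close>, and let the index of \<open>\<gamma> < lam\<close> be the least
  \<open>j < \<kappa>\<close> with \<open>cf \<gamma> < f j\<close>.  Call an unbounded \<open>B \<subseteq> \<kappa>\<close> a pattern of a club \<open>E\<close> if for some
  \<open>\<delta> \<in> S \<inter> E\<close> and every \<open>\<beta> < \<delta>\<close>, all sufficiently large \<open>j \<in> B\<close> are indices of points of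
  \<open>E \<inter> nacc (C \<delta>)\<close> above \<open>\<beta>\<close>.  Fairness gives every club a pattern, and a pattern of a club is a pattern
  of every larger one.  As there are at most \<open>2\<^sup>\<kappa> < lam\<close> candidates and clubs are closed under
  intersections of that length, a single \<open>B\<close> is a pattern of all clubs.  Composing the index with a
  bijection from \<open>B\<close> onto \<open>\<kappa>\<close> gives the required function.
\<close>

section \<open>Cofinality\<close>

lemma cf_le_of_cofinal:
  assumes "\<And>\<xi>. \<xi> < \<alpha> \<Longrightarrow> f \<xi> < \<gamma>" "\<And>\<beta>. \<beta> < \<gamma> \<Longrightarrow> \<exists>\<xi><\<alpha>. \<beta> \<le> f \<xi>"
  shows "cf \<gamma> \<le> (\<alpha>::'a::wellorder)"
  unfolding cf_def using assms by (intro Least_le exI[of _ f]) auto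

lemma cf_le: "cf \<gamma> \<le> (\<gamma>::'a::wellorder)"
  by (rule cf_le_of_cofinal[of _ "\<lambda>x. x"]) auto

lemma cofinal_map_exists:
  fixes \<gamma> :: "'a::wellorder"
  obtains f where "\<And>\<xi>. \<xi> < cf \<gamma> \<Longrightarrow> f \<xi> < \<gamma>" "\<And>\<beta>. \<beta> < \<gamma> \<Longrightarrow> \<exists>\<xi><cf \<gamma>. \<beta> \<le> f \<xi>"
proof -
  have "\<exists>f. f ` {..<\<gamma>} \<subseteq> {..<\<gamma>} \<and> (\<forall>\<beta><\<gamma>. \<exists>\<xi><\<gamma>. \<beta> \<le> f \<xi>)"
    by (rule exI[of _ "\<lambda>x. x"]) auto
  from LeastI[of "\<lambda>\<alpha>. \<exists>f. f ` {..<\<alpha>} \<subseteq> {..<\<gamma>} \<and> (\<forall>\<beta><\<gamma>. \<exists>\<xi><\<alpha>. \<beta> \<le> f \<xi>)", OF this]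
  obtain f where "f ` {..<cf \<gamma>} \<subseteq> {..<\<gamma>}" "\<forall>\<beta><\<gamma>. \<exists>\<xi><cf \<gamma>. \<beta> \<le> f \<xi>"
    unfolding cf_def by blast
  then show thesis by (intro that[of f]) auto
qed

text \<open>By minimality of \<open>cf \<gamma>\<close>, the restriction of \<open>f\<close> to
  \<open>{..<\<alpha>}\<close> is not cofinal in \<gamma>; the single value
  \<open>f \<alpha>\<close> is then absorbed by a maximum. No monotonicity of \<open>f\<close> is
  involved, so later arguments can use such bounds for arbitrary maps.\<close>

lemma bounded_below_cf:
  fixes \<gamma> :: "'a::wellorder"
  assumes "\<alpha> < cf \<gamma>" "\<And>\<xi>. \<xi> \<le> \<alpha> \<Longrightarrow> f \<xi> < \<gamma>"
  shows "\<exists>\<beta><\<gamma>. \<forall>\<xi>\<le>\<alpha>. f \<xi> \<le> \<beta>"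
proof -
  obtain \<beta> where \<beta>: "\<beta> < \<gamma>" "\<And>\<xi>. \<xi> < \<alpha> \<Longrightarrow> f \<xi> < \<beta>"
    using cf_le_of_cofinal[of \<alpha> f \<gamma>] assms by (meson leD leI less_imp_le)
  show ?thesis
  proof (intro exI[of _ "max \<beta> (f \<alpha>)"] conjI allI impI)
    show "max \<beta> (f \<alpha>) < \<gamma>" using \<beta>(1) assms(2) by simp
    show "f \<xi> \<le> max \<beta> (f \<alpha>)" if "\<xi> \<le> \<alpha>" for \<xi>
      using \<beta>(2)[of \<xi>, THEN less_imp_le] that by (cases "\<xi> = \<alpha>") (simp_all add: le_max_iff_disj)
  qed
qed

lemma cf_cf: "cf (cf \<gamma>) = cf (\<gamma>::'a::wellorder)"
proof (rule antisym[OF cf_le])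
  obtain f where f: "\<And>\<xi>. \<xi> < cf \<gamma> \<Longrightarrow> f \<xi> < \<gamma>" "\<And>\<beta>. \<beta> < \<gamma> \<Longrightarrow> \<exists>\<xi><cf \<gamma>. \<beta> \<le> f \<xi>"
    using cofinal_map_exists by blast
  obtain h where h: "\<And>\<xi>. \<xi> < cf (cf \<gamma>) \<Longrightarrow> h \<xi> < cf \<gamma>"
    "\<And>\<beta>. \<beta> < cf \<gamma> \<Longrightarrow> \<exists>\<xi><cf (cf \<gamma>). \<beta> \<le> h \<xi>"
    using cofinal_map_exists by blast
  \<comment> \<open>As \<open>f\<close> may fail to be monotone, \<open>f\<close> composed with
    \<open>h\<close> need not be cofinal. Bounding all values of \<open>f\<close> up to
    \<open>h i\<close> repairs this.\<close>
  have "\<exists>\<beta><\<gamma>. \<forall>\<xi>\<le>h i. f \<xi> \<le> \<beta>" if "i < cf (cf \<gamma>)" for i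
    using h(1)[OF that] f(1) by (intro bounded_below_cf) (auto intro: le_less_trans)
  then obtain b where b: "\<And>i. i < cf (cf \<gamma>) \<Longrightarrow> b i < \<gamma> \<and> (\<forall>\<xi>\<le>h i. f \<xi> \<le> b i)"
    by metis
  show "cf \<gamma> \<le> cf (cf \<gamma>)"
    using b f(2) h(2) by (intro cf_le_of_cofinal[of _ b]) (auto, meson order_trans)
qed

text \<open>If \<open>B\<close> were smaller than \<kappa>, it would be the image of some
  \<open>{..<a}\<close> with \<open>a\<close> below \<kappa>, and regularity would bound it.\<close>

lemma unbounded_bij_regular:
  fixes \<kappa> :: "'a::wellorder"
  assumes reg: "cf \<kappa> = \<kappa>" and B: "B \<subseteq> {..<\<kappa>}" "\<And>\<beta>. \<beta> < \<kappa> \<Longrightarrow> \<exists>\<xi>\<in>B. \<beta> < \<xi>"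
  shows "\<exists>\<phi>. bij_betw \<phi> B {..<\<kappa>}"
proof -
  have "|B| \<le>o |{..<\<kappa>}|"
    using B(1) by (rule card_of_mono1)
  moreover have "\<not> |B| <o |{..<\<kappa>}|"
  proof
    assume less: "|B| <o |{..<\<kappa>}|"
    \<comment> \<open>With \<open>r\<close> the order of \<kappa> itself, a cardinal below
      \<open>r\<close> is isomorphic to a proper initial segment of \<open>r\<close>, that is, to an
      ordinal \<open>a\<close>.\<close>
    define r where "r = {(x,y). x \<le> y \<and> y < \<kappa>}"
    have fld: "Field r = {..<\<kappa>}"
      unfolding r_def Field_def by auto
    have "wf (r - Id)"
      by (rule wf_subset[OF wf]) (auto simp: r_def)
    then have wo: "Well_order r"
      unfolding well_order_on_def linear_order_on_def partial_order_on_def preorder_on_def fld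
      by (auto simp: r_def refl_on_def trans_def antisym_def total_on_def)
    then have "|{..<\<kappa>}| \<le>o r"
      using card_of_least fld by metis
    with less have "|B| <o r" by (rule ordLess_ordLeq_trans)
    then obtain a where a: "a \<in> Field r" "|B| =o Restr r (underS r a)"
      using ordLess_iff_ordIso_Restr[OF wo card_of_Well_order, of B] by blast
    have a_less: "a < \<kappa>" using a(1) unfolding fld by simp
    then have und: "underS r a = {..<a}"
      unfolding underS_def r_def by (auto simp: order_le_less)
    have "Restr r {..<a} = {(x,y). x \<le> y \<and> y < a}"
      using a_less unfolding r_def by auto
    then have "Field (Restr r (underS r a)) = {..<a}"
      unfolding und Field_def by auto
    with a(2) obtain e where e: "bij_betw e {..<a} B"
      using ordIso_symmetric[OF a(2)] unfolding ordIso_def iso_def by (auto simp: Field_card_of)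
    \<comment> \<open>The value at \<open>a\<close> is a filler: \<open>bounded_below_cf\<close>
      speaks of the closed segment up to \<open>a\<close>, while \<open>e\<close> is controlled only
      below \<open>a\<close>.\<close>
    have "\<exists>\<beta><\<kappa>. \<forall>\<xi>\<le>a. (if \<xi> < a then e \<xi> else a) \<le> \<beta>"
      using a_less reg e B(1)
      by (intro bounded_below_cf) (auto simp: bij_betw_def)
    then obtain \<beta> where "\<beta> < \<kappa>" "\<And>\<xi>. \<xi> < a \<Longrightarrow> e \<xi> \<le> \<beta>"
      by (metis less_imp_le)
    moreover from B(2)[OF this(1)] obtain \<xi> where "\<xi> \<in> B" "\<beta> < \<xi>" by blast
    ultimately show False using e unfolding bij_betw_def by (metis imageE lessThan_iff not_le)
  qed
  ultimately show ?thesis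
    using card_of_ordIso ordLeq_iff_ordLess_or_ordIso by blast
qed

section \<open>Successor cardinals\<close>

lemma card_of_insert_le:
  assumes "infinite B" "|A| \<le>o |B|"
  shows "|insert x A| \<le>o |B|"
proof -
  have "|{x}| \<le>o |B|" using assms(1) by (intro card_of_singl_ordLeq) auto
  then have "|{x} \<union> A| \<le>o |B|"
    using assms by (intro card_of_Un_ordLeq_infinite_Field) (simp_all add: Field_card_of card_of_card_order_on)
  then show ?thesis by simp
qed

text \<open>An infinite successor ordinal has the same cardinality as its predecessor, so it is not
  a cardinal.\<close>

lemma infinite_cardinal_limit:
  fixes \<mu> :: "'a::wellorder"
  assumes "is_cardinal \<mu>" "infinite {..<\<mu>}" "\<beta> < \<mu>"
  shows "\<exists>\<gamma><\<mu>. \<beta> < \<gamma>"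
proof (rule ccontr)
  assume "\<not> ?thesis"
  then have eq: "{..<\<mu>} = insert \<beta> {..<\<beta>}"
    using assms(3) by (auto simp: neq_iff)
  then have "infinite {..<\<beta>}" using assms(2) by auto
  then have "|{..<\<mu>}| \<le>o |{..<\<beta>}|"
    unfolding eq using ordLeq_refl[OF card_of_Card_order] by (rule card_of_insert_le)
  with assms(1,3) show False
    unfolding is_cardinal_def using not_ordLeq_ordLess by blast
qed

locale succ_cardinal =
  fixes lam \<mu> :: "'a::wellorder"
  assumes succ: "is_succ_cardinal lam \<mu>"
    and inf_mu: "infinite {..<\<mu>}"
begin

lemma mu_less: "\<mu> < lam"
  using succ unfolding is_succ_cardinal_def by blast

text \<open>Otherwise the least ordinal of cardinality greater than that of \<mu> would be a
  cardinal above \<mu> and below \<open>lam\<close>.\<close>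

lemma card_below:
  assumes "\<gamma> < lam"
  shows "|{..<\<gamma>}| \<le>o |{..<\<mu>}|"
proof (rule ccontr)
  let ?P = "\<lambda>\<kappa>::'a. |{..<\<mu>}| <o |{..<\<kappa>}|"
  assume "\<not> ?thesis"
  then have P: "?P \<gamma>" using not_ordLeq_iff_ordLess[OF card_of_Well_order card_of_Well_order] by blast
  define \<kappa> where "\<kappa> = (LEAST \<kappa>. ?P \<kappa>)"
  have k: "?P \<kappa>" "\<kappa> \<le> \<gamma>"
    unfolding \<kappa>_def using P by (rule LeastI, rule Least_le)
  have "is_cardinal \<kappa>"
    unfolding is_cardinal_def
  proof (intro allI impI)
    fix \<alpha> assume "\<alpha> < \<kappa>"
    then have "\<not> ?P \<alpha>" unfolding \<kappa>_def by (rule not_less_Least)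
    then have "|{..<\<alpha>}| \<le>o |{..<\<mu>}|" using not_ordLess_iff_ordLeq[OF card_of_Well_order card_of_Well_order] by blast
    then show "|{..<\<alpha>}| <o |{..<\<kappa>}|" using k(1) by (rule ordLeq_ordLess_trans)
  qed
  moreover have "\<mu> < \<kappa>"
  proof (rule ccontr)
    assume "\<not> \<mu> < \<kappa>"
    then have "|{..<\<kappa>}| \<le>o |{..<\<mu>}|" by (intro card_of_mono1) auto
    with k(1) show False using not_ordLeq_ordLess by blast
  qed
  ultimately have "lam \<le> \<kappa>" using succ unfolding is_succ_cardinal_def by blast
  with k(2) assms show False by auto
qed

lemma card_atMost:
  assumes "\<gamma> < lam"
  shows "|{..\<gamma>}| \<le>o |{..<\<mu>}|"
proof -
  have "{..\<gamma>} = insert \<gamma> {..<\<gamma>}" by auto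
  then show ?thesis using card_of_insert_le[OF inf_mu card_below[OF assms]] by metis
qed

text \<open>This is the regularity of \<open>lam\<close>: an unbounded \<open>X\<close> would make
  \<open>lam\<close> a union of at most |\<mu>| sets, each of size at most |\<mu>|.\<close>

lemma bounded_if_small:
  assumes "X \<subseteq> {..<lam}" "|X| \<le>o |{..<\<mu>}|"
  shows "\<exists>\<beta><lam. \<forall>x\<in>X. x < \<beta>"
proof (rule ccontr)
  assume "\<not> ?thesis"
  then have "{..<lam} \<subseteq> (\<Union>x\<in>X. {..x})" by (force simp: not_less)
  then have "|{..<lam}| \<le>o |\<Union>x\<in>X. {..x}|" by (rule card_of_mono1)
  also have "|\<Union>x\<in>X. {..x}| \<le>o |{..<\<mu>}|"
    using assms card_atMost inf_mu by (intro card_of_UNION_ordLeq_infinite) auto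
  finally have "|{..<lam}| \<le>o |{..<\<mu>}|" .
  moreover have "|{..<\<mu>}| <o |{..<lam}|"
    using succ unfolding is_succ_cardinal_def is_cardinal_def by blast
  ultimately show False using not_ordLeq_ordLess by blast
qed

lemma lam_limit:
  assumes "\<beta> < lam" shows "\<exists>\<gamma><lam. \<beta> < \<gamma>"
proof (rule infinite_cardinal_limit[OF _ _ assms])
  show "is_cardinal lam" using succ unfolding is_succ_cardinal_def by blast
  show "infinite {..<lam}"
    using inf_mu mu_less finite_subset[of "{..<\<mu>}" "{..<lam}"] by (auto dest: less_imp_le)
qed

lemma club_lessThan: "club_in lam {..<lam}"
  unfolding club_in_def using lam_limit by auto

lemma club_INT:
  assumes K: "K \<noteq> {}" "|K| \<le>o |{..<\<mu>}|" and E: "\<And>k. k \<in> K \<Longrightarrow> club_in lam (E k)"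
  shows "club_in lam (\<Inter>k\<in>K. E k)"
  unfolding club_in_def
proof (intro conjI allI impI)
  show "(\<Inter>k\<in>K. E k) \<subseteq> {..<lam}"
  proof -
    obtain k where k: "k \<in> K" using K(1) by blast
    then have "E k \<subseteq> {..<lam}" using E[OF k] unfolding club_in_def by (elim conjE)
    then show ?thesis using k by auto
  qed
next
  fix \<gamma> assume \<gamma>: "\<gamma> < lam"
    and sup: "(\<Inter>k\<in>K. E k) \<inter> {..<\<gamma>} \<noteq> {} \<and> osup ((\<Inter>k\<in>K. E k) \<inter> {..<\<gamma>}) = \<gamma>"
  show "\<gamma> \<in> (\<Inter>k\<in>K. E k)"
  proof
    fix k assume k: "k \<in> K"
    have "osup (E k \<inter> {..<\<gamma>}) = \<gamma>"
      unfolding osup_def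
    proof (rule Least_equality)
      fix u assume "\<forall>\<xi>\<in>E k \<inter> {..<\<gamma>}. \<xi> \<le> u"
      then have "osup ((\<Inter>k\<in>K. E k) \<inter> {..<\<gamma>}) \<le> u"
        unfolding osup_def using k by (intro Least_le) auto
      with sup show "\<gamma> \<le> u" by simp
    qed auto
    moreover have "E k \<inter> {..<\<gamma>} \<noteq> {}" using sup k by auto
    ultimately show "\<gamma> \<in> E k" using E[OF k] \<gamma> unfolding club_in_def by blast
  qed
next
  fix \<beta> assume \<beta>: "\<beta> < lam"
  \<comment> \<open>Iterating this step gives an \<omega>-sequence \<open>b\<close> such that every
    \<open>E k\<close> has a point between consecutive terms. Its supremum stays below
    \<open>lam\<close> by regularity and is a limit of all the \<open>E k\<close> at once.\<close>
  have "\<exists>y<lam. x < y \<and> (\<forall>k\<in>K. \<exists>e\<in>E k. x < e \<and> e < y)" if x: "x < lam" for x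
  proof -
    have "\<forall>k\<in>K. \<exists>e\<in>E k. x < e" using E x unfolding club_in_def by blast
    then obtain e where e: "\<And>k. k \<in> K \<Longrightarrow> e k \<in> E k \<and> x < e k" by metis
    have "e k < lam" if "k \<in> K" for k
      using e[OF that] E[OF that] unfolding club_in_def by auto
    then have "e ` K \<subseteq> {..<lam}" by auto
    moreover have "|e ` K| \<le>o |{..<\<mu>}|"
      using card_of_image K(2) by (rule ordLeq_transitive)
    ultimately obtain y where y: "y < lam" "\<And>k. k \<in> K \<Longrightarrow> e k < y"
      using bounded_if_small by (metis imageI)
    moreover have "x < y" using K(1) e y(2) less_trans by blast
    ultimately show ?thesis using e by blast
  qed
  then obtain s where s: "\<And>x. x < lam \<Longrightarrow> s x < lam \<and> x < s x \<and> (\<forall>k\<in>K. \<exists>e\<in>E k. x < e \<and> e < s x)"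
    by metis
  define b where "b n = (s ^^ n) \<beta>" for n
  have b_less: "b n < lam" for n
    by (induction n) (use \<beta> s in \<open>auto simp: b_def\<close>)
  have b_Suc: "b n < b (Suc n)" "\<And>k. k \<in> K \<Longrightarrow> \<exists>e\<in>E k. b n < e \<and> e < b (Suc n)" for n
    using s[OF b_less[of n]] by (auto simp: b_def)
  have "|range b| \<le>o |{..<\<mu>}|"
    using card_of_image inf_mu infinite_iff_card_of_nat ordLeq_transitive by blast
  then obtain c where c: "c < lam" "\<And>n. b n < c"
    using bounded_if_small[of "range b"] b_less by auto
  define \<gamma> where "\<gamma> = (LEAST c. \<forall>n. b n \<le> c)"
  have ub: "b n \<le> \<gamma>" for n
    using LeastI[of "\<lambda>c. \<forall>n. b n \<le> c" c] c(2) unfolding \<gamma>_def by (auto simp: less_imp_le)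
  have least: "\<gamma> \<le> u" if "\<And>n. b n \<le> u" for u
    unfolding \<gamma>_def using that by (intro Least_le) auto
  have \<gamma>: "\<gamma> < lam" using least[of c] c by (meson le_less_trans less_imp_le)
  have "\<gamma> \<in> E k" if k: "k \<in> K" for k
  proof -
    have e: "\<exists>e\<in>E k \<inter> {..<\<gamma>}. b n < e" for n
      using b_Suc(2)[OF k, of n] ub[of "Suc n"] by (meson IntI less_le_trans lessThan_iff)
    have "osup (E k \<inter> {..<\<gamma>}) = \<gamma>"
      unfolding osup_def
    proof (rule Least_equality)
      fix u assume u: "\<forall>\<xi>\<in>E k \<inter> {..<\<gamma>}. \<xi> \<le> u"
      show "\<gamma> \<le> u" using e u by (intro least) (meson less_imp_le order_trans)
    qed auto
    then show ?thesis using E[OF k] \<gamma> e unfolding club_in_def by blast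
  qed
  moreover have "\<beta> < \<gamma>" using b_Suc(1)[of 0] ub[of 1] by (simp add: b_def)
  ultimately show "\<exists>\<gamma>\<in>\<Inter>k\<in>K. E k. \<beta> < \<gamma>" by blast
qed

text \<open>A surjection from \<mu> onto a nonzero \<gamma> gives
  \<open>cf \<gamma> \<le> \<mu>\<close>. Equality is impossible: \<mu> would be a cofinality, hence
  regular by \<open>cf_cf\<close>.\<close>

lemma cf_less_singular:
  assumes "cf \<mu> < \<mu>" "\<gamma> < lam"
  shows "cf \<gamma> < \<mu>"
proof -
  have "cf \<gamma> \<le> \<mu>"
  proof (cases "{..<\<gamma>} = {}")
    case True
    then have "\<not> \<mu> < \<gamma>" by blast
    then show ?thesis using cf_le[of \<gamma>] by simp
  next
    case False
    then obtain f where "f ` {..<\<mu>} = {..<\<gamma>}"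
      using card_below[OF assms(2)] card_of_ordLeq2 by metis
    then have f: "f \<xi> < \<gamma>" "\<beta> < \<gamma> \<Longrightarrow> \<exists>\<xi><\<mu>. \<beta> = f \<xi>" if "\<xi> < \<mu>" for \<xi> \<beta>
      using that by (auto simp: set_eq_iff image_iff)
    show ?thesis
    proof (rule cf_le_of_cofinal[of \<mu> f])
      show "f \<xi> < \<gamma>" if "\<xi> < \<mu>" for \<xi> using f(1)[OF that] .
      show "\<exists>\<xi><\<mu>. \<beta> \<le> f \<xi>" if "\<beta> < \<gamma>" for \<beta> using f(2)[OF assms(1) that] by auto
    qed
  qed
  moreover have "cf \<gamma> \<noteq> \<mu>" using cf_cf[of \<gamma>] assms(1) by auto
  ultimately show ?thesis by simp
qed

end

section \<open>Fair pairs\<close>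

text \<open>The generators are directed: a finite union lies in the generator with the maximal
  parameters. Membership in the ideal thus means inclusion in a single generator. The assumption
  \<open>pos\<close> supplies a generator for the empty union.\<close>

lemma notin_fair_ideal_iff:
  fixes \<mu> \<delta> :: "'a::wellorder"
  assumes pos: "\<alpha>\<^sub>0 < \<mu>" "\<beta>\<^sub>0 < \<delta>" and X: "X \<subseteq> D"
  shows "X \<notin> generated_ideal D
      {{\<gamma> \<in> D. \<gamma> \<in> acc D \<or> cf \<gamma> < \<alpha> \<or> \<gamma> < \<beta>} | \<alpha> \<beta>. \<alpha> < \<mu> \<and> \<beta> < \<delta>} \<longleftrightarrow>
    (\<forall>\<alpha><\<mu>. \<forall>\<beta><\<delta>. \<exists>\<gamma>\<in>X \<inter> nacc D. \<alpha> \<le> cf \<gamma> \<and> \<beta> \<le> \<gamma>)"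
    (is "X \<notin> generated_ideal D ?G \<longleftrightarrow> _")
proof -
  let ?g = "\<lambda>\<alpha> \<beta>. {\<gamma> \<in> D. \<gamma> \<in> acc D \<or> cf \<gamma> < \<alpha> \<or> \<gamma> < \<beta>}"
  have one: "\<exists>\<alpha><\<mu>. \<exists>\<beta><\<delta>. \<Union>F \<subseteq> ?g \<alpha> \<beta>" if "finite F" "F \<subseteq> ?G" for F
    using that
  proof (induction F)
    case empty
    then show ?case using pos by auto
  next
    case (insert A F)
    then obtain \<alpha> \<beta> \<alpha>' \<beta>' where "\<alpha> < \<mu>" "\<beta> < \<delta>" "\<Union>F \<subseteq> ?g \<alpha> \<beta>" "\<alpha>' < \<mu>" "\<beta>' < \<delta>" "A = ?g \<alpha>' \<beta>'"
      by auto
    then show ?case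
      by (intro exI[of _ "max \<alpha> \<alpha>'"] conjI exI[of _ "max \<beta> \<beta>'"]) (auto simp: less_max_iff_disj)
  qed
  have "X \<in> generated_ideal D ?G \<longleftrightarrow> (\<exists>\<alpha><\<mu>. \<exists>\<beta><\<delta>. X \<subseteq> ?g \<alpha> \<beta>)"
  proof
    assume "X \<in> generated_ideal D ?G"
    then show "\<exists>\<alpha><\<mu>. \<exists>\<beta><\<delta>. X \<subseteq> ?g \<alpha> \<beta>"
      unfolding generated_ideal_def using one by (smt (verit) mem_Collect_eq subset_trans)
  next
    assume "\<exists>\<alpha><\<mu>. \<exists>\<beta><\<delta>. X \<subseteq> ?g \<alpha> \<beta>"
    then obtain \<alpha> \<beta> where "\<alpha> < \<mu>" "\<beta> < \<delta>" "X \<subseteq> ?g \<alpha> \<beta>" by blast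
    then show "X \<in> generated_ideal D ?G"
      unfolding generated_ideal_def using X by (intro CollectI conjI exI[of _ "{?g \<alpha> \<beta>}"]) auto
  qed
  moreover have "X \<subseteq> ?g \<alpha> \<beta> \<longleftrightarrow> \<not> (\<exists>\<gamma>\<in>X \<inter> nacc D. \<alpha> \<le> cf \<gamma> \<and> \<beta> \<le> \<gamma>)" for \<alpha> \<beta>
    using X unfolding acc_def by (auto simp: not_le)
  ultimately show ?thesis by blast
qed

theorem theorem6p3:
  fixes lam \<mu> :: "'a::wellorder"
    and S :: "'a set"
    and C :: "'a \<Rightarrow> 'a set"
    and I :: "'a \<Rightarrow> 'a set set"
  assumes "singular_cardinal \<mu>"
    and "is_succ_cardinal lam \<mu>"
    and "S \<subseteq> {\<delta>. \<delta> < lam \<and> cf \<delta> = cf \<mu>}"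
    and "stationary_in lam S"
    and "fair_pair lam \<mu> S C I"
    and "ctwo ^c |{..<cf \<mu>}| <o |{..<\<mu>}|"
  shows "\<exists>g :: 'a \<Rightarrow> 'a. g ` {..<lam} \<subseteq> {..<cf \<mu>} \<and>
           image_ideal g {..<lam} {..<cf \<mu>} (id_p lam S C I) = bounded_ideal (cf \<mu>)"
proof -
  have mu: "is_cardinal \<mu>" "infinite {..<\<mu>}" "cf \<mu> < \<mu>"
    using assms(1) unfolding singular_cardinal_def by auto
  interpret succ_cardinal lam \<mu>
    using assms(2) mu(2) by unfold_locales
  define \<kappa> where "\<kappa> = cf \<mu>"
  have k_reg: "cf \<kappa> = \<kappa>" unfolding \<kappa>_def by (rule cf_cf)
  obtain f where f: "\<And>\<xi>. \<xi> < \<kappa> \<Longrightarrow> f \<xi> < \<mu>" "\<And>\<beta>. \<beta> < \<mu> \<Longrightarrow> \<exists>\<xi><\<kappa>. \<beta> \<le> f \<xi>"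
    unfolding \<kappa>_def using cofinal_map_exists by blast
  have f_bdd: "\<exists>\<beta><\<mu>. \<forall>j\<le>i. f j \<le> \<beta>" if "i < \<kappa>" for i
    using that f(1) by (intro bounded_below_cf) (auto simp: \<kappa>_def)
  have k_bdd: "\<exists>\<beta><\<kappa>. \<forall>j\<le>i. h j \<le> \<beta>" if "i < \<kappa>" "\<And>j. j < \<kappa> \<Longrightarrow> h j < \<kappa>" for i h
    using that k_reg by (intro bounded_below_cf) auto
  have S: "\<delta> < lam" "cf \<delta> = \<kappa>" if "\<delta> \<in> S" for \<delta>
    using assms(3) that unfolding \<kappa>_def by auto
  have pos: "\<exists>\<beta>. \<beta> < \<delta>" if "\<delta> \<in> S" for \<delta>
  proof -
    obtain \<xi> where "\<xi> < \<kappa>" using f(2)[OF mu(3)] by blast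
    then show "\<exists>\<beta>. \<beta> < \<delta>" using cf_le[of \<delta>] S(2)[OF that] less_le_trans by metis
  qed
  have notin_I: "X \<notin> I \<delta> \<longleftrightarrow> (\<forall>\<alpha><\<mu>. \<forall>\<beta><\<delta>. \<exists>\<gamma>\<in>X \<inter> nacc (C \<delta>). \<alpha> \<le> cf \<gamma> \<and> \<beta> \<le> \<gamma>)"
    if "\<delta> \<in> S" "X \<subseteq> C \<delta>" for \<delta> X
    using mu(3) pos[OF that(1)] that notin_fair_ideal_iff[of _ \<mu> _ \<delta> X "C \<delta>"] assms(5)
    unfolding fair_pair_def by auto
  have nacc_sub: "nacc D \<subseteq> D" for D :: "'a set" unfolding nacc_def by auto

  \<comment> \<open>Indices of ordinals and patterns of clubs\<close>
  define idx where "idx \<gamma> = (LEAST j. j < \<kappa> \<and> cf \<gamma> < f j)" for \<gamma>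
  have idx: "idx \<gamma> < \<kappa> \<and> cf \<gamma> < f (idx \<gamma>)" if \<gamma>: "\<gamma> < lam" for \<gamma>
  proof -
    obtain \<alpha> where \<alpha>: "\<alpha> < \<mu>" "cf \<gamma> < \<alpha>"
      using infinite_cardinal_limit[OF mu(1,2) cf_less_singular[OF mu(3) \<gamma>]] by blast
    obtain j where "j < \<kappa>" "\<alpha> \<le> f j" using f(2)[OF \<alpha>(1)] by blast
    then have "j < \<kappa> \<and> cf \<gamma> < f j" using \<alpha>(2) by auto
    then show ?thesis unfolding idx_def by (rule LeastI)
  qed
  \<comment> \<open>Together with \<open>idx\<close> this makes the index a measure of cofinality in
    both directions: bounded indices mean cofinalities bounded below \<mu>, and large indices force
    large cofinalities.\<close>
  have idx_ge: "f j \<le> cf \<gamma>" if "j < idx \<gamma>" "\<gamma> < lam" for j \<gamma>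
    using not_less_Least[OF that(1)[unfolded idx_def]] idx[OF that(2)] that(1) by auto

  \<comment> \<open>The witness \<delta> is quantified away because it varies with the club. Only a
    subset of \<kappa> is remembered, so there are few candidates. The threshold
    \<open>j\<^sub>0\<close> depends on \<beta>, since for larger \<beta> more of the early points
    are lost.\<close>
  define pat where "pat E B \<longleftrightarrow> (\<forall>\<beta><\<kappa>. \<exists>j\<in>B. \<beta> < j) \<and>
    (\<exists>\<delta>\<in>S \<inter> E. \<forall>\<beta><\<delta>. \<exists>j\<^sub>0<\<kappa>. \<forall>j\<in>B. j\<^sub>0 < j \<longrightarrow>
       (\<exists>\<gamma>\<in>E \<inter> nacc (C \<delta>). idx \<gamma> = j \<and> \<beta> \<le> \<gamma>))" for E B
  have pat_mono: "pat E' B" if p: "pat E B" "E \<subseteq> E'" for E E' B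
  proof -
    obtain \<delta> where \<delta>: "\<delta> \<in> S" "\<delta> \<in> E" "\<And>\<beta>. \<beta> < \<delta> \<Longrightarrow> \<exists>j\<^sub>0<\<kappa>. \<forall>j\<in>B. j\<^sub>0 < j \<longrightarrow>
        (\<exists>\<gamma>\<in>E \<inter> nacc (C \<delta>). idx \<gamma> = j \<and> \<beta> \<le> \<gamma>)"
      using p(1) unfolding pat_def by blast
    have "\<forall>\<beta><\<delta>. \<exists>j\<^sub>0<\<kappa>. \<forall>j\<in>B. j\<^sub>0 < j \<longrightarrow> (\<exists>\<gamma>\<in>E' \<inter> nacc (C \<delta>). idx \<gamma> = j \<and> \<beta> \<le> \<gamma>)"
      using \<delta>(3) p(2) by (meson IntE IntI subsetD)
    then show ?thesis using p \<delta>(1,2) unfolding pat_def by blast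
  qed
  have pat_ex: "\<exists>B\<subseteq>{..<\<kappa>}. pat E B" if E: "club_in lam E" for E
  proof -
    \<comment> \<open>The stationary set provided by fairness for \<open>E\<close> is intersected
      with the same club \<open>E\<close>.\<close>
    have "{\<delta>\<in>S. E \<inter> C \<delta> \<notin> I \<delta>} \<inter> E \<noteq> {}"
      using assms(5) E unfolding fair_pair_def stationary_in_def by blast
    then obtain \<delta> where \<delta>: "\<delta> \<in> S" "\<delta> \<in> E" "E \<inter> C \<delta> \<notin> I \<delta>" by blast
    obtain d where d: "\<And>\<xi>. \<xi> < \<kappa> \<Longrightarrow> d \<xi> < \<delta>" "\<And>\<beta>. \<beta> < \<delta> \<Longrightarrow> \<exists>\<xi><\<kappa>. \<beta> \<le> d \<xi>"
      using cofinal_map_exists[of \<delta>] S(2)[OF \<delta>(1)] by auto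
    \<comment> \<open>As \<delta> and \<mu> have the same cofinality \<kappa>, one enumeration of
      length \<kappa> drives both the index and the position in \<delta> upwards.\<close>
    have "\<exists>\<gamma>\<in>E \<inter> nacc (C \<delta>). i < idx \<gamma> \<and> (\<forall>i'\<le>i. d i' \<le> \<gamma>)" if i: "i < \<kappa>" for i
    proof -
      obtain \<alpha> where \<alpha>: "\<alpha> < \<mu>" "\<And>j. j \<le> i \<Longrightarrow> f j \<le> \<alpha>" using f_bdd[OF i] by blast
      have "\<exists>\<beta><\<delta>. \<forall>j\<le>i. d j \<le> \<beta>"
        using i d(1) S(2)[OF \<delta>(1)] by (intro bounded_below_cf) auto
      then obtain \<beta> where \<beta>: "\<beta> < \<delta>" "\<And>j. j \<le> i \<Longrightarrow> d j \<le> \<beta>" by blast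
      obtain \<gamma> where \<gamma>: "\<gamma> \<in> E \<inter> nacc (C \<delta>)" "\<alpha> \<le> cf \<gamma>" "\<beta> \<le> \<gamma>"
        using notin_I[OF \<delta>(1), of "E \<inter> C \<delta>"] \<delta>(3) \<alpha>(1) \<beta>(1) by blast
      have "\<gamma> < lam" using \<gamma>(1) E unfolding club_in_def by auto
      \<comment> \<open>An index at most \<open>i\<close> would give \<open>cf \<gamma> < f (idx
        \<gamma>) \<le> \<alpha> \<le> cf \<gamma>\<close>.\<close>
      then have "i < idx \<gamma>"
        using idx \<alpha>(2) \<gamma>(2) by (meson leD le_less_trans not_le order_trans)
      then show ?thesis using \<gamma> \<beta>(2) by (meson order_trans)
    qed
    then obtain c where c: "\<And>i. i < \<kappa> \<Longrightarrow> c i \<in> E \<inter> nacc (C \<delta>)" "\<And>i. i < \<kappa> \<Longrightarrow> i < idx (c i)"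
      "\<And>i i'. i < \<kappa> \<Longrightarrow> i' \<le> i \<Longrightarrow> d i' \<le> c i" by metis
    have idx_c: "idx (c i) < \<kappa>" if "i < \<kappa>" for i
      using c(1)[OF that] E idx unfolding club_in_def by blast
    define B where "B = (\<lambda>i. idx (c i)) ` {..<\<kappa>}"
    have "\<exists>j\<^sub>0<\<kappa>. \<forall>j\<in>B. j\<^sub>0 < j \<longrightarrow> (\<exists>\<gamma>\<in>E \<inter> nacc (C \<delta>). idx \<gamma> = j \<and> \<beta> \<le> \<gamma>)" if \<beta>: "\<beta> < \<delta>" for \<beta>
    proof -
      obtain i\<^sub>0 where i\<^sub>0: "i\<^sub>0 < \<kappa>" "\<beta> \<le> d i\<^sub>0" using d(2)[OF \<beta>] by blast
      \<comment> \<open>By regularity of \<kappa> the indices of the points \<open>c i\<close> with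
        \<open>i \<le> i\<^sub>0\<close> are bounded. A larger index in \<open>B\<close> therefore
        comes from a later \<open>c i\<close>, which lies above \<open>d i\<^sub>0\<close> and hence
        above \<beta>.\<close>
      obtain j\<^sub>0 where j\<^sub>0: "j\<^sub>0 < \<kappa>" "\<And>i. i \<le> i\<^sub>0 \<Longrightarrow> idx (c i) \<le> j\<^sub>0"
        using k_bdd[OF i\<^sub>0(1), of "\<lambda>i. idx (c i)"] idx_c by blast
      have "\<exists>\<gamma>\<in>E \<inter> nacc (C \<delta>). idx \<gamma> = j \<and> \<beta> \<le> \<gamma>" if j: "j \<in> B" "j\<^sub>0 < j" for j
      proof -
        obtain i where i: "i < \<kappa>" "j = idx (c i)" using j(1) unfolding B_def by auto
        then have "i\<^sub>0 \<le> i" using j(2) j\<^sub>0(2)[of i] by (meson leD linear)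
        then have "\<beta> \<le> c i" using c(3)[OF i(1)] i\<^sub>0(2) order_trans by blast
        then show ?thesis using c(1)[OF i(1)] i(2) by blast
      qed
      then show ?thesis using j\<^sub>0(1) by blast
    qed
    then have "pat E B" unfolding pat_def using \<delta> c(2) unfolding B_def by blast
    moreover have "B \<subseteq> {..<\<kappa>}" unfolding B_def using idx_c by auto
    ultimately show ?thesis by blast
  qed

  \<comment> \<open>A single pattern for all clubs\<close>
  have card_pat: "|Pow {..<\<kappa>}| \<le>o |{..<\<mu>}|"
  proof -
    have "|Pow {..<\<kappa>}| =o ctwo ^c |{..<cf \<mu>}|"
      unfolding \<kappa>_def cexp_def ctwo_def by (simp add: Field_card_of card_of_Pow_Func)
    then show ?thesis
      using assms(6) ordIso_ordLess_trans ordLess_imp_ordLeq by blast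
  qed
  have "\<exists>B\<subseteq>{..<\<kappa>}. \<forall>E. club_in lam E \<longrightarrow> pat E B"
  proof (rule ccontr)
    assume "\<not> ?thesis"
    \<comment> \<open>Each candidate is given a club where it fails. A pattern of the intersection
      of these clubs is one of the candidates, and \<open>pat_mono\<close> makes it succeed at its
      own club.\<close>
    then obtain E where E: "\<And>B. B \<in> Pow {..<\<kappa>} \<Longrightarrow> club_in lam (E B) \<and> \<not> pat (E B) B"
      by (metis PowD)
    have "club_in lam (\<Inter>B\<in>Pow {..<\<kappa>}. E B)"
      using E card_pat by (intro club_INT) auto
    then obtain B where B: "B \<subseteq> {..<\<kappa>}" "pat (\<Inter>B\<in>Pow {..<\<kappa>}. E B) B"
      using pat_ex by blast
    then have "pat (E B) B" by (intro pat_mono[OF B(2)]) auto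
    then show False using E B(1) by blast
  qed
  then obtain B where B: "B \<subseteq> {..<\<kappa>}" "\<And>E. club_in lam E \<Longrightarrow> pat E B" by blast
  have B_unb: "\<exists>j\<in>B. \<beta> < j" if "\<beta> < \<kappa>" for \<beta>
    using B(2)[OF club_lessThan] that unfolding pat_def by blast
  obtain \<phi> where \<phi>: "bij_betw \<phi> B {..<\<kappa>}"
    using unbounded_bij_regular[OF k_reg B(1) B_unb] by blast

  \<comment> \<open>The function \<open>g\<close>\<close>
  define \<psi> where "\<psi> = inv_into B \<phi>"
  have \<psi>: "\<psi> i \<in> B" "\<phi> (\<psi> i) = i" if "i < \<kappa>" for i
    using \<phi> that unfolding \<psi>_def bij_betw_def
    by (metis inv_into_into lessThan_iff, metis f_inv_into_f lessThan_iff)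
  have \<psi>\<phi>: "\<psi> (\<phi> j) = j" if "j \<in> B" for j
    using \<phi> that unfolding \<psi>_def by (simp add: bij_betw_def)
  \<comment> \<open>Indices outside \<open>B\<close> are left fixed rather than sent to a constant,
    so that every bounded set of values still comes from a bounded set of indices.\<close>
  define \<phi>' where "\<phi>' j = (if j \<in> B then \<phi> j else j)" for j
  have \<phi>'_less: "\<phi>' j < \<kappa>" if "j < \<kappa>" for j
    using \<phi> that unfolding \<phi>'_def bij_betw_def by auto
  define g where "g \<gamma> = \<phi>' (idx \<gamma>)" for \<gamma>

  \<comment> \<open>The image ideal of \<open>g\<close>\<close>
  have bdd_small: "g -` A \<inter> {..<lam} \<in> id_p lam S C I" if A: "\<beta> < \<kappa>" "\<And>\<xi>. \<xi> \<in> A \<Longrightarrow> \<xi> \<le> \<beta>" for A \<beta>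
  proof -
    obtain b where b: "b < \<kappa>" "\<And>i. i \<le> \<beta> \<Longrightarrow> \<psi> i \<le> b"
      using k_bdd[OF A(1), of \<psi>] \<psi>(1) B(1) by blast
    \<comment> \<open>The index of \<gamma> is \<open>\<psi> (g \<gamma>)\<close> if it lies in
      \<open>B\<close>, and \<open>g \<gamma>\<close> otherwise. Hence all cofinalities in the
      preimage are below one \<alpha>, and the whole of \<open>lam\<close> serves as the
      club.\<close>
    have bound: "idx \<gamma> \<le> max b \<beta>" if "g \<gamma> \<in> A" for \<gamma>
      using A(2)[OF that] b(2)[of "g \<gamma>"] \<psi>\<phi>[of "idx \<gamma>"]
      unfolding g_def \<phi>'_def by (auto simp: le_max_iff_disj split: if_splits)
    obtain \<alpha> where \<alpha>: "\<alpha> < \<mu>" "\<And>j. j \<le> max b \<beta> \<Longrightarrow> f j \<le> \<alpha>"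
      using f_bdd[of "max b \<beta>"] b(1) A(1) by auto
    have small: "cf \<gamma> < \<alpha>" if "g \<gamma> \<in> A" "\<gamma> < lam" for \<gamma>
      using idx[OF that(2)] \<alpha>(2)[OF bound[OF that(1)]] by auto
    have "{..<lam} \<inter> (g -` A \<inter> {..<lam}) \<inter> C \<delta> \<in> I \<delta>" if \<delta>: "\<delta> \<in> S" for \<delta>
    proof -
      obtain \<beta>\<^sub>0 where "\<beta>\<^sub>0 < \<delta>" using pos[OF \<delta>] by blast
      then show ?thesis
        using notin_I[OF \<delta>, of "{..<lam} \<inter> (g -` A \<inter> {..<lam}) \<inter> C \<delta>"] \<alpha>(1) small
        by (fastforce simp: not_le)
    qed
    then show ?thesis unfolding id_p_def using club_lessThan by blast
  qed
  have unb_large: "g -` A \<inter> {..<lam} \<notin> id_p lam S C I"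
    if A: "A \<subseteq> {..<\<kappa>}" "\<And>\<beta>. \<beta> < \<kappa> \<Longrightarrow> \<exists>\<xi>\<in>A. \<beta> < \<xi>" for A
  proof
    assume "g -` A \<inter> {..<lam} \<in> id_p lam S C I"
    then obtain E where E: "club_in lam E" "\<And>\<delta>. \<delta> \<in> S \<inter> E \<Longrightarrow> E \<inter> (g -` A \<inter> {..<lam}) \<inter> C \<delta> \<in> I \<delta>"
      unfolding id_p_def by blast
    obtain \<delta> where \<delta>: "\<delta> \<in> S" "\<delta> \<in> E"
      "\<And>\<beta>. \<beta> < \<delta> \<Longrightarrow> \<exists>j\<^sub>0<\<kappa>. \<forall>j\<in>B. j\<^sub>0 < j \<longrightarrow> (\<exists>\<gamma>\<in>E \<inter> nacc (C \<delta>). idx \<gamma> = j \<and> \<beta> \<le> \<gamma>)"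
      using B(2)[OF E(1)] unfolding pat_def by blast
    have "\<exists>\<gamma>\<in>E \<inter> (g -` A \<inter> {..<lam}) \<inter> C \<delta> \<inter> nacc (C \<delta>). \<alpha> \<le> cf \<gamma> \<and> \<beta> \<le> \<gamma>"
      if \<alpha>: "\<alpha> < \<mu>" and \<beta>: "\<beta> < \<delta>" for \<alpha> \<beta>
    proof -
      obtain j\<^sub>0 where j\<^sub>0: "j\<^sub>0 < \<kappa>"
        "\<And>j. j \<in> B \<Longrightarrow> j\<^sub>0 < j \<Longrightarrow> \<exists>\<gamma>\<in>E \<inter> nacc (C \<delta>). idx \<gamma> = j \<and> \<beta> \<le> \<gamma>"
        using \<delta>(3)[OF \<beta>] by blast
      obtain j\<^sub>1 where j\<^sub>1: "j\<^sub>1 < \<kappa>" "\<alpha> \<le> f j\<^sub>1" using f(2)[OF \<alpha>] by blast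
      \<comment> \<open>A value \<xi> of \<open>A\<close> above \<open>b\<close> forces its index
        \<open>\<psi> \<xi>\<close> beyond both thresholds: passing \<open>j\<^sub>0\<close> yields
        a point above \<beta>, and passing \<open>j\<^sub>1\<close> makes its cofinality at least
        \<alpha>.\<close>
      obtain b where b: "b < \<kappa>" "\<And>j. j \<le> max j\<^sub>0 j\<^sub>1 \<Longrightarrow> \<phi>' j \<le> b"
        using k_bdd[of "max j\<^sub>0 j\<^sub>1" \<phi>'] \<phi>'_less j\<^sub>0(1) j\<^sub>1(1) by auto
      obtain \<xi> where \<xi>: "\<xi> \<in> A" "b < \<xi>" using A(2)[OF b(1)] by blast
      then have "\<xi> < \<kappa>" using A(1) by auto
      note \<psi>\<xi> = \<psi>[OF this]
      then have eq: "\<phi>' (\<psi> \<xi>) = \<xi>" unfolding \<phi>'_def by simp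
      then have "max j\<^sub>0 j\<^sub>1 < \<psi> \<xi>" using b(2)[of "\<psi> \<xi>"] \<xi>(2) by (metis leD not_le)
      then have j: "j\<^sub>0 < \<psi> \<xi>" "j\<^sub>1 < \<psi> \<xi>" by auto
      obtain \<gamma> where \<gamma>: "\<gamma> \<in> E \<inter> nacc (C \<delta>)" "idx \<gamma> = \<psi> \<xi>" "\<beta> \<le> \<gamma>"
        using j\<^sub>0(2)[OF \<psi>\<xi>(1) j(1)] by blast
      have "\<gamma> < lam" using \<gamma>(1) E(1) unfolding club_in_def by auto
      moreover have "\<alpha> \<le> cf \<gamma>"
        using idx_ge[of j\<^sub>1 \<gamma>] j(2) \<gamma>(2) calculation j\<^sub>1(2) by simp
      moreover have "g \<gamma> \<in> A" unfolding g_def \<gamma>(2) eq by (rule \<xi>(1))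
      ultimately show ?thesis using \<gamma> nacc_sub by blast
    qed
    then have "E \<inter> (g -` A \<inter> {..<lam}) \<inter> C \<delta> \<notin> I \<delta>"
      using notin_I[OF \<delta>(1), of "E \<inter> (g -` A \<inter> {..<lam}) \<inter> C \<delta>"] by blast
    then show False using E(2) \<delta>(1,2) by blast
  qed
  have "image_ideal g {..<lam} {..<\<kappa>} (id_p lam S C I) = bounded_ideal \<kappa>"
    unfolding image_ideal_def bounded_ideal_def
    using bdd_small unb_large by (intro Collect_cong conj_cong refl) (meson not_le)
  moreover have "g ` {..<lam} \<subseteq> {..<\<kappa>}"
    unfolding g_def using idx \<phi>'_less by auto
  ultimately show ?thesis unfolding \<kappa>_def by blast
qed

end
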